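(* The worst-case performance ratio of the lower bound $\zeta(\mathrm{LP}^{\dagger}_{\mathrm N})$ for the BPPS is $$\varrho(\zeta(\mathrm{LP}^{\dagger}_{\mathrm N}))=\frac12.$$
   Context: Bin Packing Problem with Setups (BPPS). An instance consists of: a bin capacity $d\in\mathbb Z_{\ge1}$; items $\mathcal I=\{1,\dots,n\}$ with weights $w_i\in\mathbb Z_{\ge1}$; classes $\mathcal C=\{1,\dots,m\}$ and a partition $\{\mathcal I_1,\dots,\mathcal I_m\}$ of $\mathcal I$ into (nonempty) classes; for each class $c$ a setup weight $s_c\in\mathbb Z_{\ge0}$ and a setup cost $f_c\in\mathbb Z_{\ge0}$; a bin cost $r\in\mathbb Z_{\ge1}$. It is assumed that $w_i+s_c\le d$ for all $c\in\mathcal C$, $i\in\mathcal I_c$, and that the items cannot all be packed in a single bin, i.e. $\sum_{i\in\mathcal I}w_i+\sum_{c\in\mathcal C}s_c>d$. For $S\subseteq\mathcal I$ let $\mathcal C(S)=\{c\in\mathcal C: S\cap\mathcal I_c\neq\emptyset\}$. A packing pattern is a subset $S\subseteq\mathcal I$ with $\sum_{i\in S}w_i+\sum_{c\in\mathcal C(S)}s_c\le d$. A feasible solution is a partition $\mathcal S$ of $\mathcal I$ into (nonempty) packing patterns (used bins); its cost is $r|\mathcal S|+\sum_{S\in\mathcal S}\sum_{c\in\mathcal C(S)}f_c$. $OPT$ denotes the minimum cost of a feasible solution. For $c\in\mathcal C$ let $\gamma_c=\left\lceil\frac{\sum_{i\in\mathcal I_c}w_i}{d-s_c}\right\rceil$.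 For each instance let $k\in\mathbb Z_{\ge1}$ be an upper bound on the number of bins used in any optimal BPPS solution (for example $k=n$) and $\mathcal B=\{1,\dots,k\}$. The linear program $\mathrm{LP}^{\dagger}_{\mathrm N}$ is: minimize $\sum_{b\in\mathcal B}\big(r z_b+\sum_{c\in\mathcal C}f_c y_{cb}\big)$ subject to - $\sum_{b\in\mathcal B}x_{ib}=1$ for all $i\in\mathcal I$; - $\sum_{i\in\mathcal I}w_ix_{ib}+\sum_{c\in\mathcal C}s_cy_{cb}\le d\,z_b$ for all $b\in\mathcal B$; - $x_{ib}\le y_{cb}$ for all $c\in\mathcal C$, $i\in\mathcal I_c$, $b\in\mathcal B$; - $\sum_{b\in\mathcal B}y_{cb}\ge\gamma_c$ for all $c\in\mathcal C$ (Minimum Classes Inequalities); - $0\le x_{ib}\le1$, $0\le y_{cb}\le1$, $0\le z_b\le1$ for all $i\in\mathcal I,c\in\mathcal C,b\in\mathcal B$. $\zeta(\mathrm{LP}^{\dagger}_{\mathrm N})$ denotes its optimal objective function value; it is a lower bound on $OPT$. For a lower bound $LB$ on the optimum of a minimization problem, with $LB(I)$ its value and $OPT(I)>0$ the optimal value on instance $I$, the worst-case performance ratio $\varrho(LB)$ is the largest real number $\varrho\in[0,1]$ such that $LB(I)/OPT(I)\ge\varrho$ for all instances $I$. *)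

theory Defs
  imports Complex_Main "HOL-Library.Disjoint_Sets"
begin

section \<open>The bin packing problem with setups\<close>

record bpps =
  capacity :: nat
  num_items :: nat
  num_classes :: nat
  weight :: "nat \<Rightarrow> nat"
  class_items :: "nat \<Rightarrow> nat set"
  setup_weight :: "nat \<Rightarrow> nat"
  setup_cost :: "nat \<Rightarrow> nat"
  bin_cost :: nat

definition items :: "bpps \<Rightarrow> nat set" where
  "items I = {1..num_items I}"

definition classes :: "bpps \<Rightarrow> nat set" where
  "classes I = {1..num_classes I}"

definition bpps_instance :: "bpps \<Rightarrow> bool" where
  "bpps_instance I \<longleftrightarrow>
     capacity I \<ge> 1 \<and> bin_cost I \<ge> 1 \<and>
     (\<forall>i\<in>items I. weight I i \<ge> 1) \<and>
     (\<Union>c\<in>classes I. class_items I c) = items I \<and>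
     disjoint_family_on (class_items I) (classes I) \<and>
     (\<forall>c\<in>classes I. class_items I c \<noteq> {}) \<and>
     (\<forall>c\<in>classes I. \<forall>i\<in>class_items I c. weight I i + setup_weight I c \<le> capacity I) \<and>
     (\<Sum>i\<in>items I. weight I i) + (\<Sum>c\<in>classes I. setup_weight I c) > capacity I"

definition classes_of :: "bpps \<Rightarrow> nat set \<Rightarrow> nat set" where
  "classes_of I S = {c \<in> classes I. S \<inter> class_items I c \<noteq> {}}"

definition packing_pattern :: "bpps \<Rightarrow> nat set \<Rightarrow> bool" where
  "packing_pattern I S \<longleftrightarrow>
     S \<subseteq> items I \<and>
     (\<Sum>i\<in>S. weight I i) + (\<Sum>c\<in>classes_of I S. setup_weight I c) \<le> capacity I"

definition feasible_solution :: "bpps \<Rightarrow> nat set set \<Rightarrow> bool" where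
  "feasible_solution I P \<longleftrightarrow> partition_on (items I) P \<and> (\<forall>S\<in>P. packing_pattern I S)"

definition solution_cost :: "bpps \<Rightarrow> nat set set \<Rightarrow> nat" where
  "solution_cost I P = bin_cost I * card P + (\<Sum>S\<in>P. \<Sum>c\<in>classes_of I S. setup_cost I c)"

definition OPT :: "bpps \<Rightarrow> nat" where
  "OPT I = Min (solution_cost I ` {P. feasible_solution I P})"

definition optimal_solution :: "bpps \<Rightarrow> nat set set \<Rightarrow> bool" where
  "optimal_solution I P \<longleftrightarrow> feasible_solution I P \<and> solution_cost I P = OPT I"

definition bin_bound :: "bpps \<Rightarrow> nat \<Rightarrow> bool" where
  "bin_bound I k \<longleftrightarrow> k \<ge> 1 \<and> (\<forall>P. optimal_solution I P \<longrightarrow> card P \<le> k)"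


section \<open>The linear relaxation with minimum classes inequalities\<close>

definition class_bound :: "bpps \<Rightarrow> nat \<Rightarrow> int" where
  "class_bound I c =
     \<lceil>real (\<Sum>i\<in>class_items I c. weight I i) / (real (capacity I) - real (setup_weight I c))\<rceil>"

definition lp_feasible ::
  "bpps \<Rightarrow> nat \<Rightarrow> (nat \<Rightarrow> nat \<Rightarrow> real) \<Rightarrow> (nat \<Rightarrow> nat \<Rightarrow> real) \<Rightarrow> (nat \<Rightarrow> real) \<Rightarrow> bool" where
  "lp_feasible I k x y z \<longleftrightarrow>
     (\<forall>i\<in>items I. (\<Sum>b\<in>{1..k}. x i b) = 1) \<and>
     (\<forall>b\<in>{1..k}. (\<Sum>i\<in>items I. real (weight I i) * x i b)
        + (\<Sum>c\<in>classes I. real (setup_weight I c) * y c b) \<le> real (capacity I) * z b) \<and>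
     (\<forall>c\<in>classes I. \<forall>i\<in>class_items I c. \<forall>b\<in>{1..k}. x i b \<le> y c b) \<and>
     (\<forall>c\<in>classes I. (\<Sum>b\<in>{1..k}. y c b) \<ge> of_int (class_bound I c)) \<and>
     (\<forall>i\<in>items I. \<forall>b\<in>{1..k}. 0 \<le> x i b \<and> x i b \<le> 1) \<and>
     (\<forall>c\<in>classes I. \<forall>b\<in>{1..k}. 0 \<le> y c b \<and> y c b \<le> 1) \<and>
     (\<forall>b\<in>{1..k}. 0 \<le> z b \<and> z b \<le> 1)"

definition lp_objective ::
  "bpps \<Rightarrow> nat \<Rightarrow> (nat \<Rightarrow> nat \<Rightarrow> real) \<Rightarrow> (nat \<Rightarrow> real) \<Rightarrow> real" where
  "lp_objective I k y z =
     (\<Sum>b\<in>{1..k}. real (bin_cost I) * z b + (\<Sum>c\<in>classes I. real (setup_cost I c) * y c b))"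

text \<open>For an instance \<open>I\<close> with \<open>bin_bound I k\<close> the feasible region is nonempty (an optimal
  packing gives a feasible point) and compact up to irrelevant coordinates, so the infimum
  below is the optimal value of the linear program.\<close>

definition lp_value :: "bpps \<Rightarrow> nat \<Rightarrow> real" where
  "lp_value I k = Inf {lp_objective I k y z | x y z. lp_feasible I k x y z}"


section \<open>Worst-case performance ratio\<close>

definition worst_case_ratio :: "'a set \<Rightarrow> ('a \<Rightarrow> real) \<Rightarrow> ('a \<Rightarrow> real) \<Rightarrow> real" where
  "worst_case_ratio Insts opt LB =
     (GREATEST \<rho>. 0 \<le> \<rho> \<and> \<rho> \<le> 1 \<and> (\<forall>I\<in>Insts. LB I / opt I \<ge> \<rho>))"

end

theory Submission imports Defs begin

text \<open>Write \<open>W c\<close>, \<open>s c\<close>, \<open>f c\<close> for the item weight, setup weight and setup cost of class \<open>c\<close>.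
  Spreading everything evenly over the bins is optimal for the linear program, so its value is
  \<open>r / d * (\<Sum>c. W c + s c * \<gamma> c) + (\<Sum>c. f c * \<gamma> c)\<close>. To find a packing of at most twice this cost,
  split every class into fewest blocks of weight at most \<open>d - s c\<close>. Any two blocks then weigh more
  than \<open>d - s c\<close>, so a class with \<open>t c \<ge> 2\<close> blocks has \<open>t c * (d - s c) < 2 * W c\<close>, whence
  \<open>t c < 2 * \<gamma> c\<close> and \<open>t c * d \<le> 2 * (W c + s c * \<gamma> c)\<close>: its blocks may be put in bins of their own.
  The classes with a single block are packed as indivisible objects in the same greedy way. The
  pairwise count fails only if they form exactly one bin. As the items do not all fit into one
  bin, there is then a class with several blocks, and either the bin is merged with one of its
  blocks or it takes part in the pairwise count of that class, where \<open>t c + 1 \<le> 2 * \<gamma> c\<close> pays for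
  the setups. Two items of weight \<open>a + 1\<close> with capacity \<open>2 * a\<close> show that the ratio is tight.\<close>

section \<open>Greedy partitions\<close>

text \<open>Take a minimiser \<open>m\<close> of \<open>f\<close> and a second element
  \<open>b\<close>. The pair \<open>m\<close>, \<open>b\<close> contributes at least
  \<open>D\<close>, and every other element \<open>a\<close> satisfies
  \<open>D \<le> f m + f a \<le> 2 * f a\<close>. A singleton has to be excluded because it meets
  the pairwise hypothesis vacuously.\<close>

lemma sum_ge_of_pairwise_ge:
  fixes f :: "'a \<Rightarrow> nat"
  assumes "finite A" "card A \<noteq> 1"
    and pw: "\<And>a b. a \<in> A \<Longrightarrow> b \<in> A \<Longrightarrow> a \<noteq> b \<Longrightarrow> D \<le> f a + f b"
  shows "card A * D \<le> 2 * sum f A"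
proof (cases "A = {}")
  case False
  then obtain m where m: "m \<in> A" "\<And>a. a \<in> A \<Longrightarrow> f m \<le> f a"
    using arg_min_if_finite(1)[OF assms(1), of f] arg_min_least[OF assms(1), of _ f] by blast
  have "A \<noteq> {m}" using assms(2) by auto
  then obtain b where b: "b \<in> A" "b \<noteq> m" using m(1) by blast
  define R where "R = A - {m, b}"
  have fR: "finite R" and A: "A = insert m (insert b R)" and nin: "m \<notin> R" "b \<notin> R"
    using assms(1) m b by (auto simp: R_def)
  have "D \<le> 2 * f a" if "a \<in> R" for a
    using pw[of a m] m(2)[of a] m(1) that nin A by fastforce
  then have "card R * D \<le> (\<Sum>a\<in>R. 2 * f a)"
    using sum_bounded_below[of R D "\<lambda>a. 2 * f a"] by simp
  moreover have "D \<le> f m + f b" using pw m b by metis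
  ultimately show ?thesis
    using fR nin b unfolding A by (simp flip: sum_distrib_left)
qed simp

lemma partition_on_merge:
  assumes "partition_on X Q" "B \<in> Q" "C \<in> Q"
  shows "partition_on X (insert (B \<union> C) (Q - {B, C}))"
proof (rule partition_onI)
  show "\<Union> (insert (B \<union> C) (Q - {B, C})) = X"
    using assms partition_onD1[OF assms(1)] by auto
next
  show "{} \<notin> insert (B \<union> C) (Q - {B, C})" using assms partition_onD3[OF assms(1)] by auto
next
  fix p q assume "p \<in> insert (B \<union> C) (Q - {B, C})" "q \<in> insert (B \<union> C) (Q - {B, C})" "p \<noteq> q"
  then show "disjnt p q"
    using disjointD[OF partition_onD2[OF assms(1)]] assms(2,3) by (auto simp: disjnt_def)
qed

text \<open>A partition into fewest blocks works: two blocks that fit together could be merged.\<close>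

lemma ex_saturated_partition:
  fixes w :: "'a \<Rightarrow> nat"
  assumes "finite X" and "\<And>x. x \<in> X \<Longrightarrow> w x \<le> D"
  shows "\<exists>Q. partition_on X Q \<and> (\<forall>B\<in>Q. sum w B \<le> D) \<and>
    (\<forall>B\<in>Q. \<forall>C\<in>Q. B \<noteq> C \<longrightarrow> D < sum w B + sum w C)"
proof -
  let ?P = "\<lambda>Q. partition_on X Q \<and> (\<forall>B\<in>Q. sum w B \<le> D)"
  have "?P ((\<lambda>x. {x}) ` X)"
    using assms(2) by (auto simp: partition_on_singletons)
  then obtain Q where Q: "?P Q" and least: "\<And>Q'. ?P Q' \<Longrightarrow> card Q \<le> card Q'"
    using ex_has_least_nat[of ?P _ card] by metis
  have fQ: "finite Q" using Q assms(1) finite_elements by blast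
  have "D < sum w B + sum w C" if BC: "B \<in> Q" "C \<in> Q" "B \<noteq> C" for B C
  proof (rule ccontr)
    assume "\<not> D < sum w B + sum w C"
    moreover have "B \<inter> C = {}"
      using disjointD[OF partition_onD2[OF conjunct1[OF Q]] BC] .
    moreover have "finite B" "finite C"
      using BC partition_onD1[OF conjunct1[OF Q]] assms(1) by (auto intro: finite_subset)
    ultimately have "sum w (B \<union> C) \<le> D" by (simp add: sum.union_disjoint)
    \<comment> \<open>Two blocks are replaced by one admissible block, which contradicts the
      minimality of \<open>card Q\<close>.\<close>
    then have "?P (insert (B \<union> C) (Q - {B, C}))"
      using Q partition_on_merge[of X Q B C] BC by blast
    from least[OF this] have "card Q \<le> Suc (card (Q - {B, C}))"
      using card_insert_le_m1[of "Suc (card (Q - {B, C}))" "Q - {B, C}" "B \<union> C"] by linarith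
    moreover have "card (Q - {B, C}) = card Q - 2" "card Q \<ge> 2"
      using BC fQ card_mono[of Q "{B, C}"] by (auto simp: card_Diff_subset)
    ultimately show False by linarith
  qed
  with Q show ?thesis by blast
qed

section \<open>Closed form of the linear programming bound\<close>

abbreviation class_weight :: "bpps \<Rightarrow> nat \<Rightarrow> nat" where
  "class_weight I c \<equiv> \<Sum>i\<in>class_items I c. weight I i"

text \<open>A lower bound on the capacity that class \<open>c\<close> takes up in any point of the
  linear program: its items are packed once and its setup is present at least
  \<open>class_bound I c\<close> times in total.\<close>

definition padded_weight :: "bpps \<Rightarrow> nat \<Rightarrow> real" where
  "padded_weight I c = real (class_weight I c) + real (setup_weight I c) * of_int (class_bound I c)"

context
  fixes I :: bpps
  assumes inst: "bpps_instance I"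
begin

section \<open>Classes, their weights and their minimum numbers of bins\<close>

lemma finite_classes: "finite (classes I)"
  by (simp add: classes_def)

lemma class_items_subset: "c \<in> classes I \<Longrightarrow> class_items I c \<subseteq> items I"
  using inst by (auto simp: bpps_instance_def)

lemma class_items_nonempty: "c \<in> classes I \<Longrightarrow> class_items I c \<noteq> {}"
  using inst by (auto simp: bpps_instance_def)

lemma finite_class_items: "c \<in> classes I \<Longrightarrow> finite (class_items I c)"
  by (rule finite_subset[OF class_items_subset]) (auto simp: items_def)

lemma UN_class_items: "(\<Union>c\<in>classes I. class_items I c) = items I"
  using inst by (auto simp: bpps_instance_def)

lemma class_items_disjoint:
  "c \<in> classes I \<Longrightarrow> c' \<in> classes I \<Longrightarrow> c \<noteq> c' \<Longrightarrow> class_items I c \<inter> class_items I c' = {}"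
  using inst by (auto simp: bpps_instance_def disjoint_family_on_def)

lemma sum_UN_class_items:
  assumes "M \<subseteq> classes I"
  shows "(\<Sum>i\<in>(\<Union>c\<in>M. class_items I c). g i) = (\<Sum>c\<in>M. \<Sum>i\<in>class_items I c. g i)"
  by (rule sum.UNION_disjoint)
     (use assms finite_classes finite_class_items class_items_disjoint finite_subset in \<open>blast+\<close>)

lemma sum_weight_items: "(\<Sum>i\<in>items I. weight I i) = (\<Sum>c\<in>classes I. class_weight I c)"
  using sum_UN_class_items[of "classes I" "weight I"] by (simp add: UN_class_items)

text \<open>A class contains an item, and that item has weight at least 1. This makes the
  denominator in \<open>class_bound\<close> positive and lets natural subtraction
  \<open>capacity I - setup_weight I c\<close> agree with the real one.\<close>

lemma setup_weight_less_capacity: "c \<in> classes I \<Longrightarrow> setup_weight I c < capacity I"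
proof -
  assume c: "c \<in> classes I"
  then obtain i where i: "i \<in> class_items I c" using class_items_nonempty by blast
  then have "1 \<le> weight I i" "weight I i + setup_weight I c \<le> capacity I"
    using inst c class_items_subset[OF c] by (auto simp: bpps_instance_def)
  then show ?thesis by linarith
qed

lemma class_weight_pos: "c \<in> classes I \<Longrightarrow> 0 < class_weight I c"
proof -
  assume c: "c \<in> classes I"
  then obtain i where i: "i \<in> class_items I c" using class_items_nonempty by blast
  then have "1 \<le> weight I i"
    using inst class_items_subset[OF c] by (auto simp: bpps_instance_def)
  also have "weight I i \<le> class_weight I c"
    using i finite_class_items[OF c] by (simp add: member_le_sum)
  finally show ?thesis by simp
qed

lemma class_bound_pos: "c \<in> classes I \<Longrightarrow> 1 \<le> class_bound I c"
proof -
  assume c: "c \<in> classes I"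
  have "0 < real (class_weight I c) / (real (capacity I) - real (setup_weight I c))"
    using class_weight_pos[OF c] setup_weight_less_capacity[OF c] by (simp del: of_nat_sum)
  then show ?thesis unfolding class_bound_def by linarith
qed

lemma class_weight_le:
  "c \<in> classes I \<Longrightarrow>
    real (class_weight I c) \<le> of_int (class_bound I c) * (real (capacity I) - real (setup_weight I c))"
proof -
  assume c: "c \<in> classes I"
  have "real (class_weight I c) / (real (capacity I) - real (setup_weight I c)) \<le> of_int (class_bound I c)"
    unfolding class_bound_def by linarith
  then show ?thesis
    using setup_weight_less_capacity[OF c] by (simp add: pos_divide_le_eq)
qed

section \<open>Double counting over the bins of a feasible solution\<close>

lemma sum_classes_of_partition:
  assumes "finite P"
  shows "(\<Sum>S\<in>P. \<Sum>c\<in>classes_of I S. g c) =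
    (\<Sum>c\<in>classes I. of_nat (card {S \<in> P. S \<inter> class_items I c \<noteq> {}}) * (g c :: 'a :: comm_semiring_1))"
proof -
  have "(\<Sum>S\<in>P. \<Sum>c\<in>classes_of I S. g c) = (\<Sum>S\<in>P. \<Sum>c | c \<in> classes I \<and> S \<inter> class_items I c \<noteq> {}. g c)"
    by (simp add: classes_of_def)
  also have "\<dots> = (\<Sum>c\<in>classes I. \<Sum>S | S \<in> P \<and> S \<inter> class_items I c \<noteq> {}. g c)"
    using assms finite_classes by (rule sum.swap_restrict)
  finally show ?thesis by simp
qed

lemma finite_solution: "feasible_solution I P \<Longrightarrow> finite P"
  unfolding feasible_solution_def using finite_elements[of "items I" P] by (simp add: items_def)

lemma sum_partition_items:
  assumes "feasible_solution I P" "X \<subseteq> items I"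
  shows "(\<Sum>S\<in>P. \<Sum>i\<in>S \<inter> X. g i) = (\<Sum>i\<in>X. g i)"
proof -
  have part: "partition_on (items I) P" using assms by (simp add: feasible_solution_def)
  have "(\<Sum>i\<in>(\<Union>S\<in>P. S \<inter> X). g i) = (\<Sum>S\<in>P. \<Sum>i\<in>S \<inter> X. g i)"
  proof (rule sum.UNION_disjoint)
    show "finite P" using finite_solution assms(1) .
    show "\<forall>S\<in>P. finite (S \<inter> X)"
      using finite_subset[OF assms(2)] by (simp add: items_def)
    show "\<forall>S\<in>P. \<forall>T\<in>P. S \<noteq> T \<longrightarrow> S \<inter> X \<inter> (T \<inter> X) = {}"
      using partition_onD2[OF part] by (auto simp: disjoint_def)
  qed
  moreover have "(\<Union>S\<in>P. S \<inter> X) = X" using partition_onD1[OF part] assms(2) by auto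
  ultimately show ?thesis by simp
qed

text \<open>A bin meeting class \<open>c\<close> spends \<open>setup_weight I c\<close> on the
  setup, so at most \<open>capacity I - setup_weight I c\<close> remains for items of the class.
  Dividing and using that the number of bins is an integer gives the ceiling.\<close>

lemma class_bound_le_card:
  assumes P: "feasible_solution I P" and c: "c \<in> classes I"
  shows "class_bound I c \<le> int (card {S \<in> P. S \<inter> class_items I c \<noteq> {}})"
proof -
  let ?q = "{S \<in> P. S \<inter> class_items I c \<noteq> {}}"
  have "class_weight I c = (\<Sum>S\<in>P. \<Sum>i\<in>S \<inter> class_items I c. weight I i)"
    using sum_partition_items[OF P class_items_subset[OF c]] by metis
  also have "\<dots> = (\<Sum>S\<in>?q. \<Sum>i\<in>S \<inter> class_items I c. weight I i)"
    by (rule sum.mono_neutral_right) (use finite_solution[OF P] in auto)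
  also have "\<dots> \<le> (\<Sum>S\<in>?q. capacity I - setup_weight I c)"
  proof (rule sum_mono)
    fix S assume S: "S \<in> ?q"
    then have pp: "packing_pattern I S" using P by (auto simp: feasible_solution_def)
    then have fS: "finite S" using finite_subset by (auto simp: packing_pattern_def items_def)
    have "(\<Sum>i\<in>S \<inter> class_items I c. weight I i) \<le> (\<Sum>i\<in>S. weight I i)"
      using fS by (intro sum_mono2) auto
    moreover have "setup_weight I c \<le> (\<Sum>c\<in>classes_of I S. setup_weight I c)"
      using S c finite_classes by (intro member_le_sum) (auto simp: classes_of_def)
    ultimately show "(\<Sum>i\<in>S \<inter> class_items I c. weight I i) \<le> capacity I - setup_weight I c"
      using pp unfolding packing_pattern_def by linarith
  qed
  finally have "real (class_weight I c) \<le> real (card ?q * (capacity I - setup_weight I c))"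
    by (subst of_nat_le_iff) simp
  also have "\<dots> = real (card ?q) * (real (capacity I) - real (setup_weight I c))"
    using setup_weight_less_capacity[OF c] by (simp add: of_nat_diff)
  finally have "real (class_weight I c) / (real (capacity I) - real (setup_weight I c)) \<le> real (card ?q)"
    using setup_weight_less_capacity[OF c] by (simp add: pos_divide_le_eq)
  then show ?thesis unfolding class_bound_def by (simp add: ceiling_le_iff)
qed

text \<open>By \<open>class_bound_le_card\<close>, the left side is at most the total load of all
  bins, setups included, and each bin carries at most its capacity. This later keeps the evenly
  spread \<open>z\<close> at most 1.\<close>

lemma sum_padded_weight_le:
  assumes P: "feasible_solution I P"
  shows "(\<Sum>c\<in>classes I. padded_weight I c) \<le> real (card P) * real (capacity I)"
proof -
  have sub: "\<And>S. S \<in> P \<Longrightarrow> S \<subseteq> items I"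
    using P by (auto simp: feasible_solution_def packing_pattern_def)
  have "(\<Sum>c\<in>classes I. padded_weight I c) \<le> (\<Sum>c\<in>classes I. real (class_weight I c) +
      real (card {S \<in> P. S \<inter> class_items I c \<noteq> {}}) * real (setup_weight I c))"
  proof (rule sum_mono)
    fix c assume "c \<in> classes I"
    from class_bound_le_card[OF P this]
    have "of_int (class_bound I c) \<le> real (card {S \<in> P. S \<inter> class_items I c \<noteq> {}})" by linarith
    then show "padded_weight I c \<le> real (class_weight I c) +
      real (card {S \<in> P. S \<inter> class_items I c \<noteq> {}}) * real (setup_weight I c)"
      unfolding padded_weight_def by (subst mult.commute) (simp add: mult_left_mono)
  qed
  also have "\<dots> = real (\<Sum>i\<in>items I. weight I i) + (\<Sum>S\<in>P. \<Sum>c\<in>classes_of I S. real (setup_weight I c))"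
    by (simp add: sum.distrib sum_weight_items sum_classes_of_partition[OF finite_solution[OF P]])
  also have "(\<Sum>i\<in>items I. weight I i) = (\<Sum>S\<in>P. \<Sum>i\<in>S. weight I i)"
    using sum_partition_items[OF P order.refl, of "weight I"] sub by (simp add: Int_absorb2)
  also have "real \<dots> + (\<Sum>S\<in>P. \<Sum>c\<in>classes_of I S. real (setup_weight I c)) =
      real (\<Sum>S\<in>P. (\<Sum>i\<in>S. weight I i) + (\<Sum>c\<in>classes_of I S. setup_weight I c))"
    by (simp add: sum.distrib)
  also have "\<dots> \<le> real (\<Sum>S\<in>P. capacity I)"
    using P by (intro of_nat_mono sum_mono) (auto simp: feasible_solution_def packing_pattern_def)
  finally show ?thesis by simp
qed

section \<open>Existence and positivity of the optimum\<close>

lemma finite_feasible: "finite {P. feasible_solution I P}"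
proof (rule finite_subset)
  show "{P. feasible_solution I P} \<subseteq> Pow (Pow (items I))"
    by (auto simp: feasible_solution_def packing_pattern_def)
qed (simp add: items_def)

lemma OPT_le: "feasible_solution I P \<Longrightarrow> OPT I \<le> solution_cost I P"
  unfolding OPT_def using finite_feasible by (intro Min_le) auto

lemma ex_optimal:
  assumes "feasible_solution I P"
  shows "\<exists>P. optimal_solution I P"
proof -
  have "OPT I \<in> solution_cost I ` {P. feasible_solution I P}"
    unfolding OPT_def using finite_feasible assms by (intro Min_in) auto
  then show ?thesis by (auto simp: optimal_solution_def)
qed

text \<open>Without items there are no nonempty classes, and a total weight of 0 cannot exceed the
  capacity.\<close>

lemma items_nonempty: "items I \<noteq> {}"
proof
  assume "items I = {}"
  then have "classes I = {}" using inst by (auto simp: bpps_instance_def)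
  with \<open>items I = {}\<close> inst show False by (simp add: bpps_instance_def)
qed

lemma solution_cost_pos:
  assumes "feasible_solution I P"
  shows "0 < solution_cost I P"
proof -
  have "P \<noteq> {}" using assms items_nonempty by (auto simp: feasible_solution_def partition_on_def)
  then have "0 < card P" using finite_solution[OF assms] by (simp add: card_gt_0_iff)
  then show ?thesis using inst by (auto simp: solution_cost_def bpps_instance_def)
qed

text \<open>The optimal packing \<open>P\<close> serves to show that \<open>k\<close> bins are
  enough for the even spread to respect the upper bounds 1 on \<open>y\<close> and \<open>z\<close>.
  The value obtained is the same for every admissible \<open>k\<close>.\<close>

lemma lp_value_eq:
  assumes bb: "bin_bound I k" and P: "optimal_solution I P"
  shows "lp_value I k = real (bin_cost I) * (\<Sum>c\<in>classes I. padded_weight I c) / real (capacity I) +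
    (\<Sum>c\<in>classes I. real (setup_cost I c) * of_int (class_bound I c))" (is "_ = ?v")
proof -
  let ?g = "\<lambda>c. of_int (class_bound I c) :: real"
  let ?T = "\<Sum>c\<in>classes I. padded_weight I c"
  have fe: "feasible_solution I P" using P by (simp add: optimal_solution_def)
  have k: "1 \<le> k" "card P \<le> k" using bb P by (auto simp: bin_bound_def)
  have d: "0 < real (capacity I)" using inst by (simp add: bpps_instance_def)
  have gk: "?g c \<le> real k" if "c \<in> classes I" for c
  proof -
    have "class_bound I c \<le> int (card {S \<in> P. S \<inter> class_items I c \<noteq> {}})"
      using class_bound_le_card[OF fe that] .
    also have "card {S \<in> P. S \<inter> class_items I c \<noteq> {}} \<le> card P"
      using finite_solution[OF fe] by (intro card_mono) auto
    finally show ?thesis using k by linarith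
  qed
  have T: "?T = (\<Sum>i\<in>items I. real (weight I i)) + (\<Sum>c\<in>classes I. real (setup_weight I c) * ?g c)"
    using sum_weight_items
    by (simp add: padded_weight_def sum.distrib flip: of_nat_sum)
  have T0: "0 \<le> ?T" unfolding T
    using class_bound_pos by (intro add_nonneg_nonneg sum_nonneg) force+
  have Tk: "?T \<le> real k * real (capacity I)"
    using sum_padded_weight_le[OF fe] k d by (meson mult_right_mono of_nat_le_iff order.trans of_nat_0_le_iff)
  \<comment> \<open>The even spread: every bin gets the same share of each item, each setup and the
    total padded weight. Then \<open>x \<le> y\<close> amounts to
    \<open>1 \<le> class_bound I c\<close>, and the capacity constraints hold with equality.\<close>
  let ?x = "\<lambda>i b. 1 / real k" and ?y = "\<lambda>c b. ?g c / real k"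
    and ?z = "\<lambda>b. ?T / (real k * real (capacity I))"
  have feas: "lp_feasible I k ?x ?y ?z"
    unfolding lp_feasible_def
  proof (intro conjI ballI)
    fix b
    have "(\<Sum>i\<in>items I. real (weight I i) * (1 / real k)) + (\<Sum>c\<in>classes I. real (setup_weight I c) * (?g c / real k))
      = ?T / real k" unfolding T
      by (simp add: add_divide_distrib flip: sum_divide_distrib)
    then show "(\<Sum>i\<in>items I. real (weight I i) * (1 / real k)) + (\<Sum>c\<in>classes I. real (setup_weight I c) * (?g c / real k))
      \<le> real (capacity I) * (?T / (real k * real (capacity I)))" using d by simp
  next
    fix c assume c: "c \<in> classes I"
    show "1 / real k \<le> ?g c / real k" using class_bound_pos[OF c] k
      by (intro divide_right_mono) auto
    show "0 \<le> ?g c / real k" using class_bound_pos[OF c] by simp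
    show "?g c / real k \<le> 1" using gk[OF c] k by (simp add: divide_le_eq_1)
  next
    show "0 \<le> ?z b" for b :: nat using T0 by simp
    show "?z b \<le> 1" for b :: nat using Tk k d by (simp add: divide_le_eq_1)
  qed (use k in auto)
  have obj: "lp_objective I k ?y ?z = ?v"
    using k d by (simp add: lp_objective_def distrib_left flip: sum_divide_distrib)
  have "?v \<le> lp_objective I k y z" if f: "lp_feasible I k x y z" for x y z
  proof -
    have yg: "?g c \<le> (\<Sum>b\<in>{1..k}. y c b)" if "c \<in> classes I" for c
      using f that by (auto simp: lp_feasible_def)
    \<comment> \<open>Lower bound for an arbitrary feasible point: the capacity constraints are
      summed over all bins, the items being packed exactly once and the setups entering through the
      minimum classes inequalities.\<close>
    have "?T \<le> (\<Sum>i\<in>items I. real (weight I i) * (\<Sum>b\<in>{1..k}. x i b)) +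
        (\<Sum>c\<in>classes I. real (setup_weight I c) * (\<Sum>b\<in>{1..k}. y c b))"
      unfolding T using f yg by (intro add_mono sum_mono mult_left_mono) (auto simp: lp_feasible_def)
    also have "\<dots> = (\<Sum>b\<in>{1..k}. (\<Sum>i\<in>items I. real (weight I i) * x i b) +
        (\<Sum>c\<in>classes I. real (setup_weight I c) * y c b))"
      unfolding sum.distrib sum_distrib_left
      by (subst sum.swap, subst (2) sum.swap) (rule refl)
    also have "\<dots> \<le> (\<Sum>b\<in>{1..k}. real (capacity I) * z b)"
      using f by (intro sum_mono) (simp add: lp_feasible_def)
    finally have "?T / real (capacity I) \<le> (\<Sum>b\<in>{1..k}. z b)"
      using d by (subst pos_divide_le_eq) (simp_all add: mult.commute[of _ "real (capacity I)"] sum_distrib_left)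
    then have "real (bin_cost I) * (?T / real (capacity I)) \<le> real (bin_cost I) * (\<Sum>b\<in>{1..k}. z b)"
      by (intro mult_left_mono) auto
    moreover have "(\<Sum>c\<in>classes I. real (setup_cost I c) * ?g c) \<le>
        (\<Sum>c\<in>classes I. real (setup_cost I c) * (\<Sum>b\<in>{1..k}. y c b))"
      using yg by (intro sum_mono mult_left_mono) auto
    moreover have "lp_objective I k y z = real (bin_cost I) * (\<Sum>b\<in>{1..k}. z b) +
        (\<Sum>c\<in>classes I. real (setup_cost I c) * (\<Sum>b\<in>{1..k}. y c b))"
      unfolding lp_objective_def sum.distrib sum_distrib_left by (subst (2) sum.swap) (rule refl)
    ultimately show ?thesis by simp
  qed
  then show ?thesis
    unfolding lp_value_def using feas obj
    by (intro cInf_eq_minimum) (auto, metis)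
qed

section \<open>A feasible solution of cost at most twice the bound\<close>

text \<open>Partial solutions: the items of the classes in \<open>M\<close> receive bins of their
  own. Since \<open>n\<close> and \<open>F\<close> are only upper bounds, packings of disjoint sets
  of classes combine by adding them.\<close>

definition packs :: "nat set \<Rightarrow> nat \<Rightarrow> nat \<Rightarrow> bool" where
  "packs M n F \<longleftrightarrow> (\<exists>P. partition_on (\<Union>c\<in>M. class_items I c) P \<and> (\<forall>S\<in>P. packing_pattern I S) \<and>
     card P \<le> n \<and> (\<Sum>S\<in>P. \<Sum>c\<in>classes_of I S. setup_cost I c) \<le> F)"

lemma finite_UN_class_items: "M \<subseteq> classes I \<Longrightarrow> finite (\<Union>c\<in>M. class_items I c)"
  using finite_subset[OF _ finite_classes] finite_class_items by (intro finite_UN_I) auto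

lemma packs_empty: "packs {} 0 0"
  unfolding packs_def by (rule exI[of _ "{}"]) (simp add: partition_on_def)

text \<open>The two packings cover disjoint sets of items and their bins are nonempty, so they have
  no bin in common and both counts and costs add up.\<close>

lemma packs_Un:
  assumes "packs M n F" "packs M' n' F'" "M \<inter> M' = {}" "M \<subseteq> classes I" "M' \<subseteq> classes I"
  shows "packs (M \<union> M') (n + n') (F + F')"
proof -
  let ?U = "\<lambda>M. \<Union>c\<in>M. class_items I c"
  obtain P where P: "partition_on (?U M) P" "\<forall>S\<in>P. packing_pattern I S" "card P \<le> n"
     "(\<Sum>S\<in>P. \<Sum>c\<in>classes_of I S. setup_cost I c) \<le> F" using assms(1) by (auto simp: packs_def)
  obtain P' where P': "partition_on (?U M') P'" "\<forall>S\<in>P'. packing_pattern I S" "card P' \<le> n'"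
     "(\<Sum>S\<in>P'. \<Sum>c\<in>classes_of I S. setup_cost I c) \<le> F'" using assms(2) by (auto simp: packs_def)
  have "class_items I c \<inter> class_items I c' = {}" if "c \<in> M" "c' \<in> M'" for c c'
    using class_items_disjoint[of c c'] that assms(3-5) by blast
  then have dis: "?U M \<inter> ?U M' = {}" by blast
  have fP: "finite P" "finite P'"
    using finite_elements[OF finite_UN_class_items[OF assms(4)] P(1)]
      finite_elements[OF finite_UN_class_items[OF assms(5)] P'(1)] .
  have PP': "P \<inter> P' = {}"
  proof (rule ccontr)
    assume "P \<inter> P' \<noteq> {}"
    then obtain S where S: "S \<in> P" "S \<in> P'" by blast
    then have "S \<subseteq> ?U M" "S \<subseteq> ?U M'" "S \<noteq> {}"
      using partition_onD1[OF P(1)] partition_onD1[OF P'(1)] partition_onD3[OF P(1)] by auto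
    then show False using dis by blast
  qed
  have "partition_on (?U (M \<union> M')) (P \<union> P')"
    unfolding partition_on_def
    using disjoint_union[OF partition_onD2[OF P(1)] partition_onD2[OF P'(1)]] dis
      partition_onD1[OF P(1)] partition_onD1[OF P'(1)] partition_onD3[OF P(1)] partition_onD3[OF P'(1)]
    by simp
  moreover have "\<forall>S\<in>P \<union> P'. packing_pattern I S" using P(2) P'(2) by blast
  moreover have "card (P \<union> P') \<le> n + n'" using P(3) P'(3) by (simp add: card_Un_disjoint fP PP')
  moreover have "(\<Sum>S\<in>P \<union> P'. \<Sum>c\<in>classes_of I S. setup_cost I c) \<le> F + F'"
    using P(4) P'(4) by (simp add: sum.union_disjoint fP PP')
  ultimately show ?thesis unfolding packs_def by blast
qed

lemma packs_UN:
  assumes "finite J" "\<And>j. j \<in> J \<Longrightarrow> packs (M j) (n j) (F j)"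
    and "\<And>j. j \<in> J \<Longrightarrow> M j \<subseteq> classes I"
    and "\<And>i j. i \<in> J \<Longrightarrow> j \<in> J \<Longrightarrow> i \<noteq> j \<Longrightarrow> M i \<inter> M j = {}"
  shows "packs (\<Union>j\<in>J. M j) (\<Sum>j\<in>J. n j) (\<Sum>j\<in>J. F j)"
  using assms
proof (induction J rule: finite_induct)
  case empty
  then show ?case using packs_empty by simp
next
  case (insert j J)
  have "M j \<inter> (\<Union>i\<in>J. M i) = {}" using insert.hyps(2) insert.prems(3)[of j] by blast
  moreover have "packs (\<Union>j\<in>J. M j) (\<Sum>j\<in>J. n j) (\<Sum>j\<in>J. F j)"
    using insert.prems by (intro insert.IH) auto
  ultimately have "packs (M j \<union> (\<Union>j\<in>J. M j)) (n j + (\<Sum>j\<in>J. n j)) (F j + (\<Sum>j\<in>J. F j))"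
    using insert.prems by (intro packs_Un) auto
  then show ?case using insert.hyps by simp
qed

section \<open>Packing a single class or filling a single bin\<close>

lemma classes_of_UN:
  assumes "M \<subseteq> classes I" "S \<subseteq> (\<Union>c\<in>M. class_items I c)"
  shows "classes_of I S \<subseteq> M"
proof
  fix c assume "c \<in> classes_of I S"
  then obtain i where i: "c \<in> classes I" "i \<in> S" "i \<in> class_items I c" by (auto simp: classes_of_def)
  then obtain c' where "c' \<in> M" "i \<in> class_items I c'" using assms(2) by blast
  then show "c \<in> M" using i class_items_disjoint[of c c'] assms(1) by blast
qed

lemma sum_classes_of_le:
  fixes g :: "nat \<Rightarrow> nat"
  assumes "M \<subseteq> classes I" "S \<subseteq> (\<Union>c\<in>M. class_items I c)"
  shows "(\<Sum>c\<in>classes_of I S. g c) \<le> (\<Sum>c\<in>M. g c)"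
  using classes_of_UN[OF assms] assms(1) finite_classes finite_subset by (intro sum_mono2) auto

text \<open>\<open>S\<close> may meet fewer classes than \<open>M\<close> contains, so charging the
  setups of all of \<open>M\<close> is on the safe side.\<close>

lemma packing_patternI:
  assumes "M \<subseteq> classes I" "S \<subseteq> (\<Union>c\<in>M. class_items I c)"
    and "(\<Sum>i\<in>S. weight I i) + (\<Sum>c\<in>M. setup_weight I c) \<le> capacity I"
  shows "packing_pattern I S"
proof -
  have "S \<subseteq> items I" using assms(1,2) UN_class_items by blast
  then show ?thesis using sum_classes_of_le[OF assms(1,2), of "setup_weight I"] assms(3)
    unfolding packing_pattern_def by linarith
qed

lemma packs_block:
  assumes M: "M \<subseteq> classes I" "M \<noteq> {}"
    and "(\<Sum>c\<in>M. class_weight I c + setup_weight I c) \<le> capacity I"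
  shows "packs M 1 (\<Sum>c\<in>M. setup_cost I c)"
proof -
  let ?S = "\<Union>c\<in>M. class_items I c"
  have "?S \<noteq> {}" using M class_items_nonempty by blast
  then have "partition_on ?S {?S}" by (simp add: partition_on_def)
  moreover have "packing_pattern I ?S"
    using assms(3) sum_UN_class_items[OF M(1), of "weight I"]
    by (intro packing_patternI[OF M(1)]) (auto simp: sum.distrib)
  ultimately show ?thesis unfolding packs_def
    using sum_classes_of_le[OF M(1) order.refl] by (intro exI[of _ "{?S}"]) simp
qed

text \<open>Each block fits into a bin together with the setup of \<open>c\<close>, and each such
  bin pays the setup cost of \<open>c\<close> once.\<close>

lemma packs_class:
  assumes c: "c \<in> classes I" and Q: "partition_on (class_items I c) Q"
    and fit: "\<And>B. B \<in> Q \<Longrightarrow> sum (weight I) B \<le> capacity I - setup_weight I c"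
  shows "packs {c} (card Q) (setup_cost I c * card Q)"
proof -
  have sub: "B \<subseteq> (\<Union>c\<in>{c}. class_items I c)" if "B \<in> Q" for B
    using partition_onD1[OF Q] that by auto
  have "packing_pattern I B" if "B \<in> Q" for B
    using fit[OF that] setup_weight_less_capacity[OF c] sub[OF that] c
    by (intro packing_patternI[of "{c}"]) auto
  moreover have "(\<Sum>S\<in>Q. \<Sum>c\<in>classes_of I S. setup_cost I c) \<le> (\<Sum>S\<in>Q. setup_cost I c)"
    using sum_classes_of_le[of "{c}" _ "setup_cost I"] sub c by (intro sum_mono) auto
  ultimately show ?thesis unfolding packs_def
    using Q by (intro exI[of _ Q]) (auto simp: mult.commute)
qed

text \<open>The classes of \<open>M\<close> join the bin of the block \<open>B\<close>. The number
  of bins stays that of class \<open>c\<close> alone, and only the bin of \<open>B\<close> pays the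
  setup costs of \<open>M\<close> in addition.\<close>

lemma packs_class_with_block:
  assumes c: "c \<in> classes I" and Q: "partition_on (class_items I c) Q"
    and fit: "\<And>B. B \<in> Q \<Longrightarrow> sum (weight I) B \<le> capacity I - setup_weight I c"
    and M: "M \<subseteq> classes I" "c \<notin> M" and B: "B \<in> Q"
    and add: "sum (weight I) B + setup_weight I c + (\<Sum>c\<in>M. class_weight I c + setup_weight I c) \<le> capacity I"
  shows "packs (insert c M) (card Q) (setup_cost I c * card Q + (\<Sum>c\<in>M. setup_cost I c))"
proof -
  let ?U = "\<Union>c\<in>M. class_items I c"
  let ?Q = "insert (B \<union> ?U) (Q - {B})"
  have finM: "finite M" using M finite_classes finite_subset by blast
  have "class_items I c \<inter> class_items I c' = {}" if "c' \<in> M" for c'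
    using class_items_disjoint[of c c'] that c M by blast
  then have dis: "class_items I c \<inter> ?U = {}" by blast
  have Qsub: "\<And>S. S \<in> Q \<Longrightarrow> S \<subseteq> class_items I c" using partition_onD1[OF Q] by auto
  have finQ: "finite Q" using finite_elements[OF finite_class_items[OF c] Q] .
  have finU: "finite ?U" using finite_UN_class_items M by blast
  have finB: "finite B" using finite_subset[OF Qsub[OF B] finite_class_items[OF c]] .
  have "B \<noteq> {}" using B partition_onD3[OF Q] by auto
  have part: "partition_on (\<Union>c\<in>insert c M. class_items I c) ?Q"
  proof (rule partition_onI)
    show "\<Union> ?Q = (\<Union>c\<in>insert c M. class_items I c)" using partition_onD1[OF Q] B by auto
    show "{} \<notin> ?Q" using \<open>B \<noteq> {}\<close> partition_onD3[OF Q] by auto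
    have BU: "disjnt S (B \<union> ?U)" if "S \<in> Q - {B}" for S
    proof -
      have "S \<inter> B = {}" using disjointD[OF partition_onD2[OF Q]] that B by auto
      moreover have "S \<inter> ?U = {}" using Qsub[of S] that dis by blast
      ultimately show ?thesis unfolding disjnt_def by blast
    qed
    fix p q assume pq: "p \<in> ?Q" "q \<in> ?Q" "p \<noteq> q"
    then consider "p \<in> Q" "q \<in> Q" | "p = B \<union> ?U" "q \<in> Q - {B}" | "q = B \<union> ?U" "p \<in> Q - {B}"
      by blast
    then show "disjnt p q"
    proof cases
      case 1
      then show ?thesis using disjointD[OF partition_onD2[OF Q]] pq(3) by (simp add: disjnt_def)
    qed (use BU disjnt_sym in auto)
  qed
  have pat: "packing_pattern I S" if S: "S \<in> Q" for S
    using fit[OF that] setup_weight_less_capacity[OF c] Qsub[OF that] c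
    by (intro packing_patternI[of "{c}"]) auto
  have "(\<Sum>i\<in>B \<union> ?U. weight I i) = sum (weight I) B + (\<Sum>c\<in>M. class_weight I c)"
    using finB finU Qsub[OF B] dis sum_UN_class_items[OF M(1), of "weight I"]
    by (subst sum.union_disjoint) auto
  then have pat': "packing_pattern I (B \<union> ?U)"
    using add M finM c Qsub[OF B]
    by (intro packing_patternI[of "insert c M"]) (auto simp: sum.distrib)
  \<comment> \<open>The enlarged block is new, so its term can be split off from the sum over
    \<open>?Q\<close>.\<close>
  have nin: "B \<union> ?U \<notin> Q - {B}"
  proof
    assume "B \<union> ?U \<in> Q - {B}"
    then have "B \<inter> (B \<union> ?U) = {}" using disjointD[OF partition_onD2[OF Q] B] by blast
    then show False using \<open>B \<noteq> {}\<close> by blast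
  qed
  have cQ: "card Q = Suc (card (Q - {B}))" using card.remove[OF finQ B] .
  have "(\<Sum>S\<in>Q - {B}. \<Sum>c\<in>classes_of I S. setup_cost I c) \<le> (\<Sum>S\<in>Q - {B}. setup_cost I c)"
  proof (rule sum_mono)
    fix S assume "S \<in> Q - {B}"
    then show "(\<Sum>c\<in>classes_of I S. setup_cost I c) \<le> setup_cost I c"
      using sum_classes_of_le[of "{c}" S "setup_cost I"] c Qsub[of S] by simp
  qed
  moreover have "(\<Sum>c\<in>classes_of I (B \<union> ?U). setup_cost I c) \<le> setup_cost I c + (\<Sum>c\<in>M. setup_cost I c)"
  proof -
    have "B \<union> ?U \<subseteq> (\<Union>c\<in>insert c M. class_items I c)" using Qsub[OF B] by blast
    from sum_classes_of_le[OF _ this, of "setup_cost I"] show ?thesis using c M finM by simp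
  qed
  ultimately have "(\<Sum>S\<in>?Q. \<Sum>c\<in>classes_of I S. setup_cost I c) \<le>
      setup_cost I c * card Q + (\<Sum>c\<in>M. setup_cost I c)"
    using nin finQ by (simp add: cQ mult.commute)
  moreover have "card ?Q = card Q" using nin finQ cQ by simp
  ultimately show ?thesis unfolding packs_def
    using part pat pat' by (intro exI[of _ ?Q]) auto
qed

text \<open>Bins and setup costs are estimated separately, each against one of the two terms in the
  closed form of the linear programming value; the first estimate becomes a cost after
  multiplication by \<open>bin_cost I / capacity I\<close>.\<close>

lemma ex_packs:
  "\<exists>n F. packs (classes I) n F \<and>
    real n * real (capacity I) \<le> 2 * (\<Sum>c\<in>classes I. padded_weight I c) \<and>
    real F \<le> 2 * (\<Sum>c\<in>classes I. real (setup_cost I c) * of_int (class_bound I c))"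
proof -
  let ?d = "capacity I" and ?s = "setup_weight I" and ?f = "setup_cost I"
  let ?D = "\<lambda>c. capacity I - setup_weight I c"
  let ?g = "\<lambda>c. of_int (class_bound I c) :: real"
  have "\<exists>Q. partition_on (class_items I c) Q \<and> (\<forall>B\<in>Q. sum (weight I) B \<le> ?D c) \<and>
    (\<forall>B\<in>Q. \<forall>C\<in>Q. B \<noteq> C \<longrightarrow> ?D c < sum (weight I) B + sum (weight I) C)"
    if c: "c \<in> classes I" for c
  proof (rule ex_saturated_partition[OF finite_class_items[OF c]])
    fix i assume "i \<in> class_items I c"
    then have "weight I i + setup_weight I c \<le> capacity I"
      using inst c by (auto simp: bpps_instance_def)
    then show "weight I i \<le> ?D c" by linarith
  qed
  then obtain Q where Q: "\<And>c. c \<in> classes I \<Longrightarrow> partition_on (class_items I c) (Q c)"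
    and fit: "\<And>c B. c \<in> classes I \<Longrightarrow> B \<in> Q c \<Longrightarrow> sum (weight I) B \<le> ?D c"
    and sat: "\<And>c B C. c \<in> classes I \<Longrightarrow> B \<in> Q c \<Longrightarrow> C \<in> Q c \<Longrightarrow> B \<noteq> C \<Longrightarrow>
      ?D c < sum (weight I) B + sum (weight I) C"
    by metis
  define t where "t c = card (Q c)" for c
  have finQ: "finite (Q c)" if "c \<in> classes I" for c
    using finite_elements[OF finite_class_items Q] that by blast
  have sumQ: "sum (sum (weight I)) (Q c) = class_weight I c" if "c \<in> classes I" for c
    using sum.partition[OF finite_class_items Q] that by metis
  have Dreal: "real (?D c) = real ?d - real (?s c)" if "c \<in> classes I" for c
    using setup_weight_less_capacity[OF that] by simp
  \<comment> \<open>The summand 1 records that two blocks weigh strictly more than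
    \<open>?D c\<close>; this strictness is what gives \<open>t c < 2 * ?g c\<close> below.\<close>
  have two_weight: "real (t c) * (real (?D c) + 1) \<le> 2 * real (class_weight I c)"
    if c: "c \<in> classes I" and "t c \<noteq> 1" for c
  proof -
    have "card (Q c) * Suc (?D c) \<le> 2 * sum (sum (weight I)) (Q c)"
      using finQ[OF c] that(2) sat[OF c] by (intro sum_ge_of_pairwise_ge) (auto simp: t_def Suc_le_eq)
    then have "real (card (Q c) * Suc (?D c)) \<le> real (2 * class_weight I c)"
      unfolding sumQ[OF c] by (rule of_nat_mono)
    then show ?thesis by (simp only: t_def of_nat_mult of_nat_Suc of_nat_numeral add.commute)
  qed
  \<comment> \<open>For several blocks,
    \<open>t c * ?D c < 2 * class_weight I c \<le> 2 * ?g c * ?D c\<close>, and integrality turns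
    \<open>t c < 2 * ?g c\<close> into a gain of 1. This gain pays for one further setup when the
    bin of small classes is counted together with class \<open>c\<close>.\<close>
  have t_le: "real (t c) + 1 \<le> 2 * ?g c" if c: "c \<in> classes I" for c
  proof (cases "t c = 1")
    case True
    then show ?thesis using class_bound_pos[OF c] by simp
  next
    case False
    have D: "0 < real (?D c)" using setup_weight_less_capacity[OF c] by simp
    have "0 < t c" using False two_weight[OF c] class_weight_pos[OF c] finQ[OF c] sumQ[OF c]
      by (cases "Q c = {}") (auto simp: t_def card_gt_0_iff)
    then have "real (t c) * real (?D c) < 2 * real (class_weight I c)"
      using two_weight[OF c False] by (simp add: algebra_simps del: of_nat_sum)
    also have "\<dots> \<le> 2 * ?g c * real (?D c)"
      using class_weight_le[OF c] Dreal[OF c] by simp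
    finally have "real_of_int (int (t c)) < real_of_int (2 * class_bound I c)"
      using D by (simp only: mult_less_cancel_right_pos of_int_of_nat_eq of_int_mult of_int_numeral)
    then have "int (t c) + 1 \<le> 2 * class_bound I c" by (simp only: of_int_less_iff)
    then show ?thesis by linarith
  qed
  have cost: "real (?f c * t c) \<le> 2 * (real (?f c) * ?g c)" if "c \<in> classes I" for c
    using mult_left_mono[of "real (t c)" "2 * ?g c" "real (?f c)"] t_le[OF that] by simp
  \<comment> \<open>Classes have positive weight, so \<open>t c\<close> is never 0 and
    \<open>Big\<close> consists of the classes with at least two blocks.\<close>
  define Big where "Big = {c \<in> classes I. t c \<noteq> 1}"
  define Small where "Small = {c \<in> classes I. t c = 1}"
  have parts: "classes I = Small \<union> Big" "Small \<inter> Big = {}" "Small \<subseteq> classes I" "Big \<subseteq> classes I"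
    by (auto simp: Big_def Small_def)
  have fin: "finite Small" "finite Big" using parts finite_classes by (auto intro: finite_subset)
  \<comment> \<open>The capacity is split as \<open>?s c + ?D c\<close>: \<open>t_le\<close> bounds
    the setup part and \<open>two_weight\<close> the item part.\<close>
  have big: "real (t c) * real ?d \<le> 2 * padded_weight I c" if c: "c \<in> Big" for c
  proof -
    have cc: "c \<in> classes I" "t c \<noteq> 1" using c by (auto simp: Big_def)
    have "real (t c) * real (?s c) \<le> 2 * ?g c * real (?s c)"
      using t_le[OF cc(1)] by (intro mult_right_mono) auto
    moreover have "real (t c) * real (?D c) \<le> 2 * real (class_weight I c)"
      using two_weight[OF cc] by (simp add: algebra_simps del: of_nat_sum)
    ultimately show ?thesis unfolding padded_weight_def Dreal[OF cc(1)] by (simp add: algebra_simps)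
  qed
  have packs_Big: "packs J (\<Sum>c\<in>J. t c) (\<Sum>c\<in>J. ?f c * t c)" if "J \<subseteq> Big" for J
  proof -
    have "packs (\<Union>c\<in>J. {c}) (\<Sum>c\<in>J. t c) (\<Sum>c\<in>J. ?f c * t c)"
    proof (rule packs_UN)
      fix c assume "c \<in> J"
      then have "c \<in> classes I" using that parts by blast
      then show "packs {c} (t c) (?f c * t c)" "{c} \<subseteq> classes I"
        unfolding t_def using packs_class Q fit by auto
    qed (use that fin in \<open>auto intro: finite_subset\<close>)
    then show ?thesis by simp
  qed
  \<comment> \<open>A class with a single block becomes one indivisible object, its setup included.
    It fits into a bin because its only block weighs at most \<open>?D c\<close>.\<close>
  define load where "load = (\<lambda>c. class_weight I c + ?s c)"
  have load_le: "real (load c) \<le> padded_weight I c" if "c \<in> classes I" for c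
    using mult_left_mono[of 1 "?g c" "real (?s c)"] class_bound_pos[OF that]
    by (simp add: load_def padded_weight_def)
  have "load c \<le> ?d" if c: "c \<in> Small" for c
  proof -
    have cc: "c \<in> classes I" "t c = 1" using c by (auto simp: Small_def)
    then obtain B where B: "Q c = {B}" unfolding t_def using card_1_singletonE by blast
    then show ?thesis
      using fit[OF cc(1), of B] sumQ[OF cc(1)] setup_weight_less_capacity[OF cc(1)]
      by (simp add: load_def)
  qed
  then obtain N where N: "partition_on Small N"
    and Nfit': "\<forall>B\<in>N. sum load B \<le> ?d"
    and Nsat': "\<forall>B\<in>N. \<forall>C\<in>N. B \<noteq> C \<longrightarrow> ?d < sum load B + sum load C"
    using ex_saturated_partition[OF fin(1), of load ?d] by metis
  note Nfit = bspec[OF Nfit'] and Nsat = bspec[OF bspec[OF Nsat'], rule_format]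
  have UN: "\<Union> N = Small" using partition_onD1[OF N] by simp
  have finN: "finite N" using finite_elements[OF fin(1) N] .
  have sumN: "sum (sum h) N = sum h Small" for h :: "nat \<Rightarrow> nat"
    using sum.partition[OF fin(1) N] by metis
  have "packs (\<Union>B\<in>N. B) (\<Sum>B\<in>N. 1) (\<Sum>B\<in>N. \<Sum>c\<in>B. ?f c)"
  proof (rule packs_UN)
    fix B assume B: "B \<in> N"
    then show sub: "B \<subseteq> classes I" using UN parts by blast
    show "packs B 1 (\<Sum>c\<in>B. ?f c)"
    proof (rule packs_block[OF sub])
      show "B \<noteq> {}" using partition_onD3[OF N] B by blast
      show "(\<Sum>c\<in>B. class_weight I c + ?s c) \<le> ?d" using Nfit[OF B] by (simp only: load_def)
    qed
  qed (use finN disjointD[OF partition_onD2[OF N]] in auto)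
  then have packs_Small: "packs Small (card N) (\<Sum>c\<in>Small. ?f c)"
    using UN sumN[of ?f] by simp
  have split: "sum h (classes I) = sum h Small + sum h Big" for h :: "nat \<Rightarrow> real"
    unfolding parts(1) by (rule sum.union_disjoint[OF fin parts(2)])
  have cost_Small: "(\<Sum>c\<in>Small. ?f c) = (\<Sum>c\<in>Small. ?f c * t c)"
    by (rule sum.cong) (simp_all add: Small_def)
  have cost_all: "real ((\<Sum>c\<in>Small. ?f c) + (\<Sum>c\<in>Big. ?f c * t c)) \<le>
      2 * (\<Sum>c\<in>classes I. real (?f c) * ?g c)"
  proof -
    have "real ((\<Sum>c\<in>Small. ?f c) + (\<Sum>c\<in>Big. ?f c * t c)) = (\<Sum>c\<in>classes I. real (?f c * t c))"
      unfolding cost_Small split by (simp only: of_nat_add of_nat_sum)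
    also have "\<dots> \<le> (\<Sum>c\<in>classes I. 2 * (real (?f c) * ?g c))"
      using cost by (rule sum_mono)
    finally show ?thesis by (simp only: sum_distrib_left)
  qed
  note padded_split = split[of "padded_weight I"]
  have small_ge: "real (sum load Small) \<le> (\<Sum>c\<in>Small. padded_weight I c)"
    unfolding of_nat_sum using load_le parts(3) by (intro sum_mono) blast
  have bigJ: "real (\<Sum>c\<in>J. t c) * real ?d \<le> 2 * (\<Sum>c\<in>J. padded_weight I c)" if "J \<subseteq> Big" for J
  proof -
    have "real (\<Sum>c\<in>J. t c) * real ?d = (\<Sum>c\<in>J. real (t c) * real ?d)"
      by (simp only: of_nat_sum sum_distrib_right)
    also have "\<dots> \<le> (\<Sum>c\<in>J. 2 * padded_weight I c)"
      using big that by (intro sum_mono) blast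
    finally show ?thesis by (simp only: sum_distrib_left)
  qed
  have all: "packs (classes I) (card N + (\<Sum>c\<in>Big. t c)) ((\<Sum>c\<in>Small. ?f c) + (\<Sum>c\<in>Big. ?f c * t c))"
    unfolding parts(1) by (rule packs_Un[OF packs_Small packs_Big[OF order.refl] parts(2-4)])
  have enough: ?thesis
    if "real (card N + (\<Sum>c\<in>Big. t c)) * real ?d \<le> 2 * (\<Sum>c\<in>classes I. padded_weight I c)"
    using all that cost_all by blast
  show ?thesis
  proof (cases "card N = 1")
    case False
    \<comment> \<open>This case includes \<open>card N = 0\<close>. The pairwise count applies to
      the bins of small classes, and the big classes pay for themselves by
      \<open>bigJ\<close>.\<close>
    then have "card N * ?d \<le> 2 * sum (sum load) N"
      using finN Nsat by (intro sum_ge_of_pairwise_ge) (auto intro: less_imp_le)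
    then have "real (card N * ?d) \<le> real (2 * sum load Small)" unfolding sumN by (rule of_nat_mono)
    with small_ge bigJ[OF order.refl] show ?thesis
      by (intro enough) (simp add: padded_split distrib_right)
  next
    case True
    then obtain B where "N = {B}" using card_1_singletonE by blast
    then have Sd: "sum load Small \<le> ?d" using Nfit UN by simp
    \<comment> \<open>Otherwise all items and setups would fit into the one bin of small classes,
      against the assumption on instances.\<close>
    have "Big \<noteq> {}"
    proof
      assume "Big = {}"
      then have "classes I = Small" using parts by simp
      then show False
        using Sd inst sum_weight_items by (simp add: load_def sum.distrib bpps_instance_def)
    qed
    then obtain c where c: "c \<in> Big" by blast
    then have cc: "c \<in> classes I" "t c \<noteq> 1" by (auto simp: Big_def)
    show ?thesis
    proof (cases "\<exists>B\<in>Q c. sum (weight I) B + ?s c + sum load Small \<le> ?d")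
      case True
      then obtain B where "B \<in> Q c" "sum (weight I) B + ?s c + sum load Small \<le> ?d" by blast
      \<comment> \<open>The small classes share a bin with a block of \<open>c\<close>, so the big
        classes alone determine the number of bins.\<close>
      then have "packs (insert c Small) (t c) (?f c * t c + (\<Sum>c\<in>Small. ?f c))"
        unfolding t_def load_def using cc Q fit parts c
        by (intro packs_class_with_block) auto
      from packs_Un[OF this packs_Big[of "Big - {c}"]]
      have "packs (insert c Small \<union> (Big - {c})) (t c + (\<Sum>c\<in>Big - {c}. t c))
        (?f c * t c + (\<Sum>c\<in>Small. ?f c) + (\<Sum>c\<in>Big - {c}. ?f c * t c))"
        using parts cc by auto
      moreover have "insert c Small \<union> (Big - {c}) = classes I" using parts c by auto
      ultimately have "packs (classes I) (\<Sum>c\<in>Big. t c) ((\<Sum>c\<in>Small. ?f c) + (\<Sum>c\<in>Big. ?f c * t c))"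
        using sum.remove[OF fin(2) c, of t] sum.remove[OF fin(2) c, of "\<lambda>c. ?f c * t c"]
        by (simp add: add_ac)
      moreover have "real (\<Sum>c\<in>Big. t c) * real ?d \<le> 2 * (\<Sum>c\<in>classes I. padded_weight I c)"
        using order.trans[OF of_nat_0_le_iff small_ge] unfolding padded_split
        by (intro order.trans[OF bigJ[OF order.refl]]) simp
      ultimately show ?thesis using cost_all by blast
    next
      case False
      text \<open>The small bin enters the pairwise count for class \<open>c\<close> as the additional index \<open>{}\<close>,
        which is not a block of \<open>Q c\<close>.\<close>
      let ?h = "\<lambda>B. if B = {} then sum load Small else sum (weight I) B"
      have ne: "{} \<notin> Q c" using partition_onD3[OF Q[OF cc(1)]] .
      have "Q c \<noteq> {}" using sumQ[OF cc(1)] class_weight_pos[OF cc(1)] by auto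
      then have card: "card (insert {} (Q c)) = Suc (t c)" "t c \<noteq> 0"
        using ne finQ[OF cc(1)] by (auto simp: t_def)
      have "card (insert {} (Q c)) * ?D c \<le> 2 * sum ?h (insert {} (Q c))"
      proof (rule sum_ge_of_pairwise_ge)
        show "finite (insert {} (Q c))" using finQ[OF cc(1)] by simp
        show "card (insert {} (Q c)) \<noteq> 1" using card by simp
        \<comment> \<open>No block fits next to the small bin together with the setup of
          \<open>c\<close>.\<close>
        have F: "?D c \<le> sum load Small + sum (weight I) B" if "B \<in> Q c" for B
          using False that by force
        show "?D c \<le> ?h B + ?h C" if "B \<in> insert {} (Q c)" "C \<in> insert {} (Q c)" "B \<noteq> C" for B C
          using that F[of B] F[of C] sat[OF cc(1), of B C] ne by (auto simp: add.commute)
      qed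
      moreover have "sum ?h (insert {} (Q c)) = sum load Small + class_weight I c"
        using ne finQ[OF cc(1)] unfolding sumQ[OF cc(1), symmetric]
        by (subst sum.insert) (auto intro!: sum.cong)
      ultimately have "Suc (t c) * ?D c \<le> 2 * (sum load Small + class_weight I c)"
        using card by simp
      then have "real (Suc (t c) * ?D c) \<le> real (2 * (sum load Small + class_weight I c))"
        by (rule of_nat_mono)
      then have 1: "(real (t c) + 1) * (real ?d - real (?s c)) \<le> 2 * real (sum load Small) + 2 * real (class_weight I c)"
        by (simp only: Dreal[OF cc(1), symmetric] of_nat_mult of_nat_Suc of_nat_add of_nat_numeral
            distrib_left add.commute)
      have 2: "(real (t c) + 1) * real (?s c) \<le> 2 * ?g c * real (?s c)"
        using t_le[OF cc(1)] by (intro mult_right_mono) auto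
      have "(real (t c) + 1) * real ?d \<le> 2 * real (sum load Small) + 2 * padded_weight I c"
        using 1 2 unfolding padded_weight_def by (simp add: algebra_simps del: of_nat_sum)
      with bigJ[of "Big - {c}"] small_ge
      have "real (1 + (\<Sum>c\<in>Big. t c)) * real ?d \<le> 2 * (\<Sum>c\<in>classes I. padded_weight I c)"
        unfolding padded_split sum.remove[OF fin(2) c]
        by (simp add: algebra_simps del: of_nat_sum)
      then show ?thesis using \<open>card N = 1\<close> by (intro enough) simp
    qed
  qed
qed

text \<open>The packing from \<open>ex_packs\<close> costs at most twice the closed form of
  \<open>lp_value\<close>. Positivity of \<open>OPT I\<close> allows dividing by it.\<close>

lemma OPT_le_twice_lp_value:
  assumes bb: "bin_bound I k"
  shows "0 < OPT I" "real (OPT I) \<le> 2 * lp_value I k"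
proof -
  obtain n F where packs: "packs (classes I) n F"
    and n: "real n * real (capacity I) \<le> 2 * (\<Sum>c\<in>classes I. padded_weight I c)"
    and F: "real F \<le> 2 * (\<Sum>c\<in>classes I. real (setup_cost I c) * of_int (class_bound I c))"
    using ex_packs by blast
  obtain P where P: "feasible_solution I P" "card P \<le> n"
    "(\<Sum>S\<in>P. \<Sum>c\<in>classes_of I S. setup_cost I c) \<le> F"
    using packs unfolding packs_def feasible_solution_def UN_class_items by blast
  obtain R where R: "optimal_solution I R" using ex_optimal P(1) by blast
  then show "0 < OPT I" using solution_cost_pos[of R] by (simp add: optimal_solution_def)
  have d: "0 < real (capacity I)" using inst by (simp add: bpps_instance_def)
  have "OPT I \<le> bin_cost I * n + F"
    using OPT_le[OF P(1)] P(2,3) unfolding solution_cost_def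
    by (meson add_mono le_trans mult_le_mono2)
  then have "real (OPT I) \<le> real (bin_cost I * n + F)" by (rule of_nat_mono)
  also have "\<dots> = real (bin_cost I) * real n + real F" by simp
  also have "\<dots> \<le> real (bin_cost I) * (2 * (\<Sum>c\<in>classes I. padded_weight I c) / real (capacity I)) +
      2 * (\<Sum>c\<in>classes I. real (setup_cost I c) * of_int (class_bound I c))"
    using n F d by (intro add_mono mult_left_mono) (simp_all add: pos_le_divide_eq)
  also have "\<dots> = 2 * lp_value I k" unfolding lp_value_eq[OF bb R] by simp
  finally show "real (OPT I) \<le> 2 * lp_value I k" .
qed

end

section \<open>Tightness\<close>

text \<open>Ordinary bin packing, as setups weigh and cost nothing. The total weight
  \<open>2 * a + 2\<close> barely exceeds one bin for large \<open>a\<close>, yet the two items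
  cannot share a bin.\<close>

definition tight_instance :: "nat \<Rightarrow> bpps" where
  "tight_instance a = \<lparr>capacity = 2 * a, num_items = 2, num_classes = 1, weight = (\<lambda>_. a + 1),
     class_items = (\<lambda>_. {1, 2}), setup_weight = (\<lambda>_. 0), setup_cost = (\<lambda>_. 0), bin_cost = 1\<rparr>"

lemma tight_instance:
  assumes "1 \<le> a"
  shows "bpps_instance (tight_instance a)"
proof -
  have "{1..2::nat} = {1, 2}" by auto
  then show ?thesis using assms
    by (simp add: bpps_instance_def tight_instance_def items_def classes_def disjoint_family_on_def)
qed

lemma tight_instance_solution:
  assumes "1 \<le> a"
  shows "feasible_solution (tight_instance a) P \<longleftrightarrow> P = {{1}, {2}}"
proof -
  let ?I = "tight_instance a"
  have it: "items ?I = {1, 2}" by (auto simp: tight_instance_def items_def)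
  have pp: "packing_pattern ?I S \<longleftrightarrow> S \<subseteq> {1, 2} \<and> card S \<le> 1" for S
  proof -
    have "card S * (a + 1) \<le> 2 * a \<longleftrightarrow> card S \<le> 1"
    proof
      assume "card S * (a + 1) \<le> 2 * a"
      also have "\<dots> < 2 * (a + 1)" by simp
      finally have "card S < 2" by (simp only: mult_less_cancel2)
      then show "card S \<le> 1" by linarith
    next
      assume "card S \<le> 1"
      then have "card S * (a + 1) \<le> 1 * (a + 1)" by (rule mult_le_mono1)
      also have "\<dots> \<le> 2 * a" using assms by simp
      finally show "card S * (a + 1) \<le> 2 * a" .
    qed
    then show ?thesis unfolding packing_pattern_def it by (simp add: tight_instance_def)
  qed
  show ?thesis
  proof
    assume f: "feasible_solution ?I P"
    then have part: "partition_on {1, 2} P" and small: "\<And>S. S \<in> P \<Longrightarrow> S \<subseteq> {1, 2} \<and> card S \<le> 1"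
      using pp by (auto simp: feasible_solution_def it)
    have S: "S = {1} \<or> S = {2}" if "S \<in> P" for S
    proof -
      have "finite S" "S \<noteq> {}" using small[OF that] partition_onD3[OF part] that finite_subset by auto
      then have "card S = 1" using small[OF that] card_gt_0_iff[of S] by linarith
      then obtain s where "S = {s}" by (rule card_1_singletonE)
      then show ?thesis using small[OF that] by auto
    qed
    moreover have "1 \<in> \<Union> P" "2 \<in> \<Union> P" using partition_onD1[OF part] by auto
    ultimately have "{1} \<in> P" "{2} \<in> P" by fastforce+
    with S show "P = {{1}, {2}}" by blast
  next
    assume "P = {{1}, {2}}"
    then show "feasible_solution ?I P"
      using pp by (auto simp: feasible_solution_def it partition_on_def disjoint_def)
  qed
qed

text \<open>The linear program pays \<open>(2 * a + 2) / (2 * a)\<close> bins, whereas the only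
  feasible solution uses 2.\<close>

lemma tight_instance_ratio:
  assumes a: "1 \<le> a" and bb: "bin_bound (tight_instance a) k"
  shows "lp_value (tight_instance a) k / real (OPT (tight_instance a)) = 1 / 2 + 1 / (2 * real a)"
proof -
  let ?I = "tight_instance a"
  have "{P. feasible_solution ?I P} = {{{1}, {2}}}" using tight_instance_solution[OF a] by auto
  moreover have "card {{1::nat}, {2}} = 2" by simp
  ultimately have OPT: "OPT ?I = 2"
    by (simp add: OPT_def solution_cost_def tight_instance_def)
  obtain R where "optimal_solution ?I R"
    using ex_optimal[OF tight_instance[OF a]] tight_instance_solution[OF a] by blast
  from lp_value_eq[OF tight_instance[OF a] bb this]
  have "lp_value ?I k = real (2 * (a + 1)) / real (2 * a)"
    by (simp add: tight_instance_def classes_def padded_weight_def)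
  then show ?thesis using a by (simp add: OPT field_simps)
qed

theorem proposition6:
  fixes k :: "bpps \<Rightarrow> nat"
  assumes "\<And>I. bpps_instance I \<Longrightarrow> bin_bound I (k I)"
  shows "worst_case_ratio {I. bpps_instance I} (\<lambda>I. real (OPT I)) (\<lambda>I. lp_value I (k I)) = 1 / 2"
  unfolding worst_case_ratio_def
proof (rule Greatest_equality)
  have "1 / 2 \<le> lp_value I (k I) / real (OPT I)" if "bpps_instance I" for I
    using OPT_le_twice_lp_value[OF that assms[OF that]] by (simp add: pos_le_divide_eq)
  then show "0 \<le> (1 / 2 :: real) \<and> (1 / 2 :: real) \<le> 1 \<and>
      (\<forall>I\<in>{I. bpps_instance I}. 1 / 2 \<le> lp_value I (k I) / real (OPT I))" by simp
next
  fix \<rho> :: real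
  assume "0 \<le> \<rho> \<and> \<rho> \<le> 1 \<and> (\<forall>I\<in>{I. bpps_instance I}. \<rho> \<le> lp_value I (k I) / real (OPT I))"
  then have bound: "\<rho> \<le> 1 / 2 + 1 / (2 * real a)" if "1 \<le> a" for a
    using tight_instance[OF that] tight_instance_ratio[OF that assms] by fastforce
  show "\<rho> \<le> 1 / 2"
  proof (rule ccontr)
    assume "\<not> \<rho> \<le> 1 / 2"
    \<comment> \<open>A gap above 1/2 is beaten by the tight instance with \<open>a = Suc n\<close>,
      whose ratio exceeds 1/2 by only \<open>1 / (2 * real (Suc n))\<close>.\<close>
    then obtain n where n: "1 / real (Suc n) < \<rho> - 1 / 2"
      using nat_approx_posE[of "\<rho> - 1 / 2"] by auto
    have "1 / (2 * real (Suc n)) \<le> 1 / real (Suc n)" by (simp add: field_simps)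
    with n bound[of "Suc n"] show False by simp
  qed
qed

end
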